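(* Let $n,d\ge 1$, let $\Gamma = \Gamma^T$ be a subgroup of $GL_d(\mathbb{Z}/n\mathbb{Z})$, let $\mathcal{X} = \{X_1,X_2,\ldots,X_N\}$ denote the set of superclasses (orbits) induced by the action of $\Gamma$ on $(\mathbb{Z}/n\mathbb{Z})^d$, and let $\sigma_1,\sigma_2,\ldots,\sigma_N$ denote the corresponding supercharacters. For each fixed $z$ in $X_k$, let $c_{i,j,k}$ denote the number of solutions $(x,y) \in X_i \times X_j$ to the equation $x+y = z$. Then: (1) $c_{i,j,k}$ is independent of the representative $z$ in $X_k$ which is chosen. (2) The identity $$\sigma_i(X_{\ell})\, \sigma_j(X_{\ell}) = \sum_{k=1}^N c_{i,j,k}\, \sigma_k(X_{\ell})$$ holds for $1\leq i,j,\ell \leq N$. (3) The $N\times N$ matrices $T_1,T_2,\ldots,T_N$, whose entries are given by $$[T_i]_{j,k} = \frac{ c_{i,j,k} \sqrt{ |X_k| } }{ \sqrt{ |X_j|} },$$ each satisfy $T_i U = U D_i$, where $$U = \frac{1}{\sqrt{n^d}} \left[ \frac{ \sigma_i(X_j) \sqrt{ |X_j| }}{ \sqrt{|X_i|}} \right]_{i,j=1}^N \quad\text{and}\quad D_i = \operatorname{diag}\big(\sigma_i(X_1), \sigma_i(X_2),\ldots, \sigma_i(X_N) \big).$$ (4) Each $T_i$ is a normal matrix (i.e., $T_i^*T_i = T_i T_i^*$) and the set $\{T_1,T_2,\ldots,T_N\}$ forms a basis for the algebra $\mathcal{A}$ of all $N \times N$ complex matrices $T$ such that $U^*TU$ is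 diagonal.
   Context: Here $\Gamma^T=\{A^T: A\in\Gamma\}$. The group $\Gamma$ acts on $G=(\mathbb{Z}/n\mathbb{Z})^d$ by $\mathbf{y}\mapsto A\mathbf{y}$; the orbits $X_1,\ldots,X_N$ are called superclasses. Write $e(x)=\exp(2\pi i x)$ and $\mathbf{x}\cdot\mathbf{y}=\sum_{i=1}^d x_iy_i$. The supercharacter attached to $X_i$ is the function $\sigma_i:G\to\mathbb{C}$, $\sigma_i(\boldsymbol{\xi})=\sum_{\mathbf{x}\in X_i} e\left(\frac{\mathbf{x}\cdot\boldsymbol{\xi}}{n}\right)$; it is constant on each superclass, and $\sigma_i(X_j)$ denotes its value at any element of $X_j$. The matrix $U$ is unitary, and $*$ denotes the conjugate transpose. *)

theory Defs
  imports
    "Jordan_Normal_Form.Schur_Decomposition"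
    "Jordan_Normal_Form.VS_Connect"
    "HOL-Algebra.Group_Action"
begin

text \<open>
  The ring of integers modulo \<open>n\<close> is represented by the residues \<open>{0..<n}\<close>, with
  all arithmetic reduced entrywise modulo \<open>n\<close>. This is adequate for every \<open>n \<ge> 1\<close>,
  including the zero ring \<open>n = 1\<close>.
\<close>

definition zmod_vecs :: "nat \<Rightarrow> nat \<Rightarrow> int vec set" where
  "zmod_vecs n d = {x \<in> carrier_vec d. \<forall>i<d. x $ i \<in> {0..<int n}}"

definition vec_reduce :: "nat \<Rightarrow> int vec \<Rightarrow> int vec" where
  "vec_reduce n x = map_vec (\<lambda>a. a mod int n) x"

definition mat_reduce :: "nat \<Rightarrow> int mat \<Rightarrow> int mat" where
  "mat_reduce n A = map_mat (\<lambda>a. a mod int n) A"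

definition zmod_mat_monoid :: "nat \<Rightarrow> nat \<Rightarrow> int mat monoid" where
  "zmod_mat_monoid n d =
     \<lparr>carrier = {A \<in> carrier_mat d d. \<forall>i<d. \<forall>j<d. A $$ (i, j) \<in> {0..<int n}},
      monoid.mult = (\<lambda>A B. mat_reduce n (A * B)),
      one = mat_reduce n (1\<^sub>m d)\<rparr>"

definition GL :: "nat \<Rightarrow> nat \<Rightarrow> int mat monoid" where
  "GL n d = units_of (zmod_mat_monoid n d)"

definition mat_action :: "nat \<Rightarrow> int mat \<Rightarrow> int vec \<Rightarrow> int vec" where
  "mat_action n A y = vec_reduce n (A *\<^sub>v y)"

definition superclasses :: "nat \<Rightarrow> nat \<Rightarrow> int mat set \<Rightarrow> int vec set set" where
  "superclasses n d \<Gamma> = orbits ((GL n d)\<lparr>carrier := \<Gamma>\<rparr>) (zmod_vecs n d) (mat_action n)"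

definition exp_2pi_i :: "real \<Rightarrow> complex" where
  "exp_2pi_i x = exp (2 * complex_of_real pi * \<i> * complex_of_real x)"

definition supercharacter :: "nat \<Rightarrow> int vec set \<Rightarrow> int vec \<Rightarrow> complex" where
  "supercharacter n X \<xi> = (\<Sum>x\<in>X. exp_2pi_i (real_of_int (x \<bullet> \<xi>) / real n))"

text \<open>
  The common value of the supercharacter attached to \<open>X\<close> on the superclass \<open>Y\<close>;
  see \<open>supercharacter_value_eq\<close> below for well-definedness.
\<close>
definition supercharacter_value :: "nat \<Rightarrow> int vec set \<Rightarrow> int vec set \<Rightarrow> complex" where
  "supercharacter_value n X Y = (THE v. \<forall>\<xi>\<in>Y. supercharacter n X \<xi> = v)"

lemma exp_2pi_i_cong_mod:
  assumes "n \<ge> 1" "a mod int n = b mod int n"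
  shows "exp_2pi_i (real_of_int a / real n) = exp_2pi_i (real_of_int b / real n)"
proof -
  obtain k where k: "a = b + int n * k"
    using assms(2) by (metis mod_eqE minus_diff_eq add.commute diff_add_cancel mult_minus_right uminus_add_conv_diff)
  have "real_of_int a / real n = real_of_int b / real n + real_of_int k"
    using assms(1) by (simp add: k field_simps)
  then have "exp_2pi_i (real_of_int a / real n)
      = exp_2pi_i (real_of_int b / real n) * exp (2 * of_int k * complex_of_real pi * \<i>)"
    by (simp add: exp_2pi_i_def exp_add [symmetric] algebra_simps)
  moreover have "exp (2 * of_int k * complex_of_real pi * \<i>) = 1"
  proof -
    have "exp (2 * of_int k * complex_of_real pi * \<i>) = cis (2 * pi * real_of_int k)"
      by (simp add: cis_conv_exp mult_ac)
    also have "\<dots> = 1"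
      by (simp add: cis.ctr complex_eq_iff cos_int_2pin sin_int_2pin)
    finally show ?thesis .
  qed
  ultimately show ?thesis by simp
qed

lemma sum_mult_mod_cong:
  fixes f g f' g' :: "'a \<Rightarrow> int"
  assumes "\<And>i. i \<in> I \<Longrightarrow> f i mod m = f' i mod m" "\<And>i. i \<in> I \<Longrightarrow> g i mod m = g' i mod m"
  shows "(\<Sum>i\<in>I. f i * g i) mod m = (\<Sum>i\<in>I. f' i * g' i) mod m"
proof -
  have "(\<Sum>i\<in>I. f i * g i) mod m = (\<Sum>i\<in>I. (f i * g i) mod m) mod m"
    by (simp add: mod_sum_eq)
  also have "(\<Sum>i\<in>I. (f i * g i) mod m) = (\<Sum>i\<in>I. (f' i * g' i) mod m)"
    by (intro sum.cong refl mod_mult_cong assms)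
  also have "\<dots> mod m = (\<Sum>i\<in>I. f' i * g' i) mod m"
    by (simp add: mod_sum_eq)
  finally show ?thesis .
qed

lemma scalar_prod_mod_cong:
  fixes x x' y y' :: "int vec"
  assumes "x \<in> carrier_vec d" "x' \<in> carrier_vec d" "y \<in> carrier_vec d" "y' \<in> carrier_vec d"
    and "\<And>i. i < d \<Longrightarrow> x $ i mod m = x' $ i mod m" "\<And>i. i < d \<Longrightarrow> y $ i mod m = y' $ i mod m"
  shows "(x \<bullet> y) mod m = (x' \<bullet> y') mod m"
  using assms by (auto simp: scalar_prod_def intro!: sum_mult_mod_cong)

lemma mat_action_closed:
  assumes "n \<ge> 1" "A \<in> carrier_mat d d"
  shows "mat_action n A y \<in> zmod_vecs n d"
proof -
  have "vec_reduce n w \<in> zmod_vecs n d" if "w \<in> carrier_vec d" for w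
    using that assms(1) by (auto simp: vec_reduce_def zmod_vecs_def)
  moreover have "A *\<^sub>v y \<in> carrier_vec d" using assms(2) by (intro carrier_vecI) simp
  ultimately show ?thesis by (simp add: mat_action_def)
qed

lemma mat_action_mult:
  assumes A: "A \<in> carrier_mat d d" and B: "B \<in> carrier_mat d d" and y: "y \<in> carrier_vec d"
  shows "mat_action n (mat_reduce n (A * B)) y = mat_action n A (mat_action n B y)"
proof (rule eq_vecI)
  show "dim_vec (mat_action n (mat_reduce n (A * B)) y) = dim_vec (mat_action n A (mat_action n B y))"
    by (simp add: mat_action_def vec_reduce_def mat_reduce_def)
  fix i assume "i < dim_vec (mat_action n A (mat_action n B y))"
  then have i: "i < d" using A by (simp add: mat_action_def vec_reduce_def)
  have "mat_action n (mat_reduce n (A * B)) y $ i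
      = (row (mat_reduce n (A * B)) i \<bullet> y) mod int n"
    using i A B by (simp add: mat_action_def vec_reduce_def mat_reduce_def)
  also have "\<dots> = (row (A * B) i \<bullet> y) mod int n"
    by (rule scalar_prod_mod_cong [where d = d]) (use i A B y in \<open>auto simp: mat_reduce_def\<close>)
  also have "row (A * B) i \<bullet> y = row A i \<bullet> (B *\<^sub>v y)"
  proof -
    have "row (A * B) i \<bullet> y = ((A * B) *\<^sub>v y) $ i" using i A B by simp
    also have "(A * B) *\<^sub>v y = A *\<^sub>v (B *\<^sub>v y)" using A B y by simp
    finally show ?thesis using i A by simp
  qed
  also have "\<dots> mod int n = (row A i \<bullet> mat_action n B y) mod int n"
    by (rule scalar_prod_mod_cong [where d = d])
      (use i A B y in \<open>auto simp: mat_action_def vec_reduce_def\<close>)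
  also have "\<dots> = mat_action n A (mat_action n B y) $ i"
    using i A by (simp add: mat_action_def vec_reduce_def)
  finally show "mat_action n (mat_reduce n (A * B)) y $ i = mat_action n A (mat_action n B y) $ i" .
qed

lemma mat_action_one:
  assumes "y \<in> zmod_vecs n d"
  shows "mat_action n (mat_reduce n (1\<^sub>m d)) y = y"
proof (rule eq_vecI)
  have y: "y \<in> carrier_vec d" "\<And>i. i < d \<Longrightarrow> y $ i mod int n = y $ i"
    using assms by (auto simp: zmod_vecs_def)
  then show "dim_vec (mat_action n (mat_reduce n (1\<^sub>m d)) y) = dim_vec y"
    by (simp add: mat_action_def vec_reduce_def mat_reduce_def)
  fix i assume "i < dim_vec y"
  then have i: "i < d" using y by simp
  have "mat_action n (mat_reduce n (1\<^sub>m d)) y $ i = (row (mat_reduce n (1\<^sub>m d)) i \<bullet> y) mod int n"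
    using i by (simp add: mat_action_def vec_reduce_def mat_reduce_def)
  also have "\<dots> = (row (1\<^sub>m d) i \<bullet> y) mod int n"
    by (rule scalar_prod_mod_cong [where d = d]) (use i y in \<open>auto simp: mat_reduce_def\<close>)
  also have "\<dots> = y $ i" using i y by simp
  finally show "mat_action n (mat_reduce n (1\<^sub>m d)) y $ i = y $ i" .
qed

lemma scalar_prod_mat_action:
  assumes "n \<ge> 1" and A: "A \<in> carrier_mat d d" and x: "x \<in> carrier_vec d" and y: "y \<in> carrier_vec d"
  shows "exp_2pi_i (real_of_int (x \<bullet> mat_action n A y) / real n)
       = exp_2pi_i (real_of_int (mat_action n (transpose_mat A) x \<bullet> y) / real n)"
proof (rule exp_2pi_i_cong_mod [OF assms(1)])
  have "(x \<bullet> mat_action n A y) mod int n = (x \<bullet> (A *\<^sub>v y)) mod int n"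
    by (rule scalar_prod_mod_cong [where d = d])
      (use A x y in \<open>auto simp: mat_action_def vec_reduce_def\<close>)
  also have "x \<bullet> (A *\<^sub>v y) = (transpose_mat A *\<^sub>v x) \<bullet> y"
    using transpose_vec_mult_scalar [OF A y x] by simp
  also have "\<dots> mod int n = (mat_action n (transpose_mat A) x \<bullet> y) mod int n"
    by (rule scalar_prod_mod_cong [where d = d])
      (use A x y in \<open>auto simp: mat_action_def vec_reduce_def\<close>)
  finally show "(x \<bullet> mat_action n A y) mod int n
      = (mat_action n (transpose_mat A) x \<bullet> y) mod int n" .
qed

lemma finite_zmod_vecs: "finite (zmod_vecs n d)"
proof (rule finite_subset)
  show "zmod_vecs n d \<subseteq> vec_of_list ` {xs. set xs \<subseteq> {0..<int n} \<and> length xs = d}"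
  proof
    fix x assume x: "x \<in> zmod_vecs n d"
    have "x = vec_of_list (list_of_vec x)" by (simp add: vec_list)
    moreover have "set (list_of_vec x) \<subseteq> {0..<int n}" "length (list_of_vec x) = d"
      using x by (auto simp: zmod_vecs_def set_list_of_vec vec_set_def)
    ultimately show "x \<in> vec_of_list ` {xs. set xs \<subseteq> {0..<int n} \<and> length xs = d}" by blast
  qed
  show "finite (vec_of_list ` {xs. set xs \<subseteq> {0..<int n} \<and> length xs = d})"
    by (intro finite_imageI finite_lists_length_eq) simp
qed

lemma GL_simps:
  "A \<otimes>\<^bsub>GL n d\<^esub> B = mat_reduce n (A * B)" "\<one>\<^bsub>GL n d\<^esub> = mat_reduce n (1\<^sub>m d)"
  by (simp_all add: GL_def units_of_def zmod_mat_monoid_def)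

lemma GL_carrierD: "A \<in> carrier (GL n d) \<Longrightarrow> A \<in> carrier_mat d d"
  by (auto simp: GL_def units_of_def Units_def zmod_mat_monoid_def)

lemma GL_left_inverse:
  assumes "A \<in> carrier (GL n d)"
  obtains B where "B \<in> carrier_mat d d" "mat_reduce n (B * A) = mat_reduce n (1\<^sub>m d)"
  using assms by (auto simp: GL_def units_of_def Units_def zmod_mat_monoid_def)

lemma supercharacter_mat_action:
  assumes n: "n \<ge> 1" and \<Gamma>: "subgroup \<Gamma> (GL n d)" "\<Gamma> = transpose_mat ` \<Gamma>"
    and X: "X \<in> superclasses n d \<Gamma>" and A: "A \<in> \<Gamma>" and y: "y \<in> zmod_vecs n d"
  shows "supercharacter n X (mat_action n A y) = supercharacter n X y"
proof -
  have carr: "B \<in> carrier_mat d d" if "B \<in> \<Gamma>" for B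
    using that \<Gamma>(1) by (meson GL_carrierD subgroup.mem_carrier)
  define B where "B = transpose_mat A"
  have B: "B \<in> \<Gamma>" using A \<Gamma>(2) unfolding B_def by blast
  obtain x0 where x0: "x0 \<in> zmod_vecs n d" and Xeq: "X = {mat_action n C x0 |C. C \<in> \<Gamma>}"
    using X by (auto simp: superclasses_def orbits_def orbit_def)
  have X_sub: "X \<subseteq> zmod_vecs n d"
    using mat_action_closed [OF n] carr by (auto simp: Xeq)
  have cv: "x \<in> carrier_vec d" if "x \<in> zmod_vecs n d" for x
    using that by (simp add: zmod_vecs_def)
  obtain B' where B': "B' \<in> carrier_mat d d" "mat_reduce n (B' * B) = mat_reduce n (1\<^sub>m d)"
    using GL_left_inverse B \<Gamma>(1) by (metis subgroup.mem_carrier)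
  have "inj_on (mat_action n B) X"
  proof (rule inj_on_inverseI)
    fix x assume "x \<in> X"
    then have x: "x \<in> zmod_vecs n d" using X_sub by blast
    show "mat_action n B' (mat_action n B x) = x"
      using mat_action_mult [OF B'(1) carr [OF B] cv [OF x], of n] B'(2) mat_action_one [OF x]
      by simp
  qed
  moreover have "mat_action n B ` X \<subseteq> X"
  proof
    fix z assume "z \<in> mat_action n B ` X"
    then obtain C where C: "C \<in> \<Gamma>" "z = mat_action n B (mat_action n C x0)" by (auto simp: Xeq)
    then have "z = mat_action n (mat_reduce n (B * C)) x0"
      using mat_action_mult [OF carr [OF B] carr [OF C(1)] cv [OF x0], of n] by simp
    moreover have "mat_reduce n (B * C) \<in> \<Gamma>"
      using subgroup.m_closed [OF \<Gamma>(1) B C(1)] by (simp add: GL_simps)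
    ultimately show "z \<in> X" by (auto simp: Xeq)
  qed
  ultimately have img: "mat_action n B ` X = X" and inj: "inj_on (mat_action n B) X"
    using finite_subset [OF X_sub finite_zmod_vecs] by (simp_all add: endo_inj_surj)
  have "supercharacter n X (mat_action n A y)
      = (\<Sum>x\<in>X. exp_2pi_i (real_of_int (mat_action n B x \<bullet> y) / real n))"
    unfolding supercharacter_def B_def
    by (intro sum.cong refl scalar_prod_mat_action [OF n carr [OF A]])
      (use X_sub cv y in auto)
  also have "\<dots> = (\<Sum>x\<in>mat_action n B ` X. exp_2pi_i (real_of_int (x \<bullet> y) / real n))"
    by (simp add: sum.reindex [OF inj])
  finally show ?thesis by (simp add: img supercharacter_def)
qed

lemma supercharacter_value_eq:
  assumes "n \<ge> 1" "subgroup \<Gamma> (GL n d)" "\<Gamma> = transpose_mat ` \<Gamma>"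
    and "X \<in> superclasses n d \<Gamma>" and Y: "Y \<in> superclasses n d \<Gamma>" and \<xi>: "\<xi> \<in> Y"
  shows "supercharacter_value n X Y = supercharacter n X \<xi>"
proof -
  obtain y where "y \<in> zmod_vecs n d" "Y = {mat_action n C y |C. C \<in> \<Gamma>}"
    using Y by (auto simp: superclasses_def orbits_def orbit_def)
  then have "supercharacter n X \<eta> = supercharacter n X y" if "\<eta> \<in> Y" for \<eta>
    using that supercharacter_mat_action [OF assms(1-4)] by auto
  then show ?thesis
    unfolding supercharacter_value_def using \<xi> by (intro the_equality) metis+
qed

definition num_solutions :: "nat \<Rightarrow> int vec set \<Rightarrow> int vec set \<Rightarrow> int vec \<Rightarrow> nat" where
  "num_solutions n X Y z = card {(x, y) \<in> X \<times> Y. vec_reduce n (x + y) = z}"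

text \<open>
  The common value of \<open>num_solutions n X Y z\<close> for \<open>z \<in> Z\<close>, meaningful only when this
  count does not depend on \<open>z\<close>.
\<close>
definition structure_const :: "nat \<Rightarrow> int vec set \<Rightarrow> int vec set \<Rightarrow> int vec set \<Rightarrow> nat" where
  "structure_const n X Y Z = (THE c. \<forall>z\<in>Z. num_solutions n X Y z = c)"

text \<open>In the matrices below, the superclasses are enumerated as \<open>X 0, \<dots>, X (N - 1)\<close>.\<close>

definition T_mat :: "nat \<Rightarrow> nat \<Rightarrow> (nat \<Rightarrow> int vec set) \<Rightarrow> nat \<Rightarrow> complex mat" where
  "T_mat n N X i = Matrix.mat N N (\<lambda>(j, k).
     complex_of_real (real (structure_const n (X i) (X j) (X k)) * sqrt (real (card (X k)))
       / sqrt (real (card (X j)))))"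

definition U_mat :: "nat \<Rightarrow> nat \<Rightarrow> nat \<Rightarrow> (nat \<Rightarrow> int vec set) \<Rightarrow> complex mat" where
  "U_mat n d N X = complex_of_real (1 / sqrt (real n ^ d)) \<cdot>\<^sub>m Matrix.mat N N (\<lambda>(i, j).
     supercharacter_value n (X i) (X j) * complex_of_real (sqrt (real (card (X j))))
       / complex_of_real (sqrt (real (card (X i)))))"

definition D_mat :: "nat \<Rightarrow> nat \<Rightarrow> (nat \<Rightarrow> int vec set) \<Rightarrow> nat \<Rightarrow> complex mat" where
  "D_mat n N X i = mat_diag N (\<lambda>l. supercharacter_value n (X i) (X l))"

definition diagonalized_algebra :: "nat \<Rightarrow> complex mat \<Rightarrow> (complex, complex mat) module" where
  "diagonalized_algebra N U = (module_mat TYPE(complex) N N)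
     \<lparr>carrier := {T \<in> carrier_mat N N. diagonal_mat (mat_adjoint U * T * U)}\<rparr>"

lemma vectorspace_module_mat: "vectorspace class_ring (module_mat TYPE(complex) N N)"
proof -
  interpret abelian_group "module_mat TYPE(complex) N N" by (rule abelian_group_mat)
  have "Module.module class_ring (module_mat TYPE(complex) N N)"
    by (unfold_locales)
      (auto simp: class_ring_simps module_mat_simps add_smult_distrib_left_mat add_smult_distrib_right_mat)
  then show ?thesis
    unfolding vectorspace_def using class_field by blast
qed

text \<open>The ambient structure in which bases are taken is indeed a vector space.\<close>
lemma vectorspace_diagonalized_algebra:
  assumes U: "U \<in> carrier_mat N N"
  shows "vectorspace class_ring (diagonalized_algebra N U)"
proof -
  let ?S = "{T \<in> carrier_mat N N. diagonal_mat (mat_adjoint U * T * U)}"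
  interpret vectorspace class_ring "module_mat TYPE(complex) N N" by (rule vectorspace_module_mat)
  have Ua: "mat_adjoint U \<in> carrier_mat N N"
    using U by (auto simp: mat_adjoint_def)
  have add: "mat_adjoint U * (S + T) * U = mat_adjoint U * S * U + mat_adjoint U * T * U"
    if "S \<in> carrier_mat N N" "T \<in> carrier_mat N N" for S T
    using that U Ua
    by (simp add: mult_add_distrib_mat [OF Ua that] add_mult_distrib_mat [of _ N N _ _ N])
  have smult: "mat_adjoint U * (c \<cdot>\<^sub>m T) * U = c \<cdot>\<^sub>m (mat_adjoint U * T * U)"
    if T: "T \<in> carrier_mat N N" for c T
    using T U Ua mult_smult_distrib [OF Ua T, of c]
      mult_smult_assoc_mat [OF mult_carrier_mat [OF Ua T] U, of c] by simp
  have "submodule class_ring ?S (module_mat TYPE(complex) N N)"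
    unfolding submodule_def
  proof (intro conjI allI impI)
    show "Module.module class_ring (module_mat TYPE(complex) N N)" by (rule module_axioms)
    show "?S \<subseteq> carrier (module_mat TYPE(complex) N N)" by (auto simp: module_mat_simps)
    show "\<zero>\<^bsub>module_mat TYPE(complex) N N\<^esub> \<in> ?S"
      using U Ua by (auto simp: module_mat_simps diagonal_mat_def)
    show "v \<oplus>\<^bsub>module_mat TYPE(complex) N N\<^esub> w \<in> ?S" if "v \<in> ?S" "w \<in> ?S" for v w
    proof -
      have vw: "v \<in> carrier_mat N N" "w \<in> carrier_mat N N" using that by auto
      have "mat_adjoint U * v * U \<in> carrier_mat N N" "mat_adjoint U * w * U \<in> carrier_mat N N"
        using vw U Ua by auto
      then have "diagonal_mat (mat_adjoint U * v * U + mat_adjoint U * w * U)"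
        using that unfolding diagonal_mat_def by (auto simp del: index_mult_mat(1))
      then show ?thesis using vw by (simp add: module_mat_simps add)
    qed
    show "c \<odot>\<^bsub>module_mat TYPE(complex) N N\<^esub> v \<in> ?S" if "c \<in> carrier class_ring" "v \<in> ?S" for c v
    proof -
      have v: "v \<in> carrier_mat N N" using that by auto
      have "diagonal_mat (c \<cdot>\<^sub>m (mat_adjoint U * v * U))"
        using that unfolding diagonal_mat_def by (auto simp del: index_mult_mat(1))
      then show ?thesis using v by (simp add: module_mat_simps smult)
    qed
  qed
  then have "VectorSpace.subspace class_ring ?S (module_mat TYPE(complex) N N)"
    using vectorspace_axioms by (simp add: VectorSpace.subspace_def)
  from subspace_is_vs [OF this] show ?thesis
    by (simp add: diagonalized_algebra_def)
qed

text \<open>For unitary \<open>U\<close>, the carrier is moreover closed under matrix multiplication.\<close>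
lemma diagonalized_algebra_mult_closed:
  assumes U: "U \<in> carrier_mat N N" and unitary: "U * mat_adjoint U = 1\<^sub>m N"
    and S: "S \<in> carrier (diagonalized_algebra N U)" and T: "T \<in> carrier (diagonalized_algebra N U)"
  shows "S * T \<in> carrier (diagonalized_algebra N U)"
proof -
  let ?V = "mat_adjoint U"
  have V: "?V \<in> carrier_mat N N"
    using U by (auto simp: mat_adjoint_def)
  have S': "S \<in> carrier_mat N N" "diagonal_mat (?V * S * U)"
    and T': "T \<in> carrier_mat N N" "diagonal_mat (?V * T * U)"
    using S T by (auto simp: diagonalized_algebra_def)
  have VS: "?V * S \<in> carrier_mat N N" and TU: "T * U \<in> carrier_mat N N"
    and VSU: "?V * S * U \<in> carrier_mat N N" and VTU: "?V * T * U \<in> carrier_mat N N"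
    using S' T' U V by auto
  have "?V * S * U * (?V * T * U) = ?V * S * U * (?V * (T * U))"
    by (simp add: assoc_mult_mat [OF V T'(1) U])
  also have "\<dots> = ?V * S * (U * (?V * (T * U)))"
    by (rule assoc_mult_mat [OF VS U]) (use V TU in auto)
  also have "U * (?V * (T * U)) = T * U"
    using assoc_mult_mat [OF U V TU] unfolding unitary left_mult_one_mat [OF TU] by (rule sym)
  also have "?V * S * (T * U) = ?V * S * T * U"
    by (rule assoc_mult_mat [OF VS T'(1) U, symmetric])
  also have "?V * S * T = ?V * (S * T)"
    by (rule assoc_mult_mat [OF V S'(1) T'(1)])
  finally have eq: "?V * (S * T) * U = ?V * S * U * (?V * T * U)" ..
  have prod_entry: "(P * Q) $$ (i, j) = (\<Sum>k = 0..<N. P $$ (i, k) * Q $$ (k, j))"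
    if "P \<in> carrier_mat N N" "Q \<in> carrier_mat N N" "i < N" "j < N" for P Q :: "complex mat" and i j
    using that by (simp add: scalar_prod_def)
  have entry: "(?V * S * U * (?V * T * U)) $$ (i, j) = 0" if "i < N" "j < N" "i \<noteq> j" for i j
  proof -
    have "(?V * S * U * (?V * T * U)) $$ (i, j)
        = (\<Sum>k = 0..<N. (?V * S * U) $$ (i, k) * (?V * T * U) $$ (k, j))"
      by (rule prod_entry [OF VSU VTU that(1,2)])
    also have "\<dots> = 0"
    proof (rule sum.neutral, rule ballI)
      fix k assume "k \<in> {0..<N}"
      then have "(?V * S * U) $$ (i, k) = 0 \<or> (?V * T * U) $$ (k, j) = 0"
        using that S'(2) T'(2) VSU VTU unfolding diagonal_mat_def by (metis atLeastLessThan_iff carrier_matD)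
      then show "(?V * S * U) $$ (i, k) * (?V * T * U) $$ (k, j) = 0" by simp
    qed
    finally show ?thesis .
  qed
  have "?V * S * U * (?V * T * U) \<in> carrier_mat N N" using VSU VTU by simp
  then have "diagonal_mat (?V * (S * T) * U)"
    unfolding eq diagonal_mat_def using entry by (metis carrier_matD)
  then show ?thesis using S' T' by (simp add: diagonalized_algebra_def)
qed

end

theory Submission
  imports Defs
begin

text \<open>
  Everything rests on two expressions for the supercharacters
  \<open>\<sigma>\<^sub>i(\<xi>) = \<Sum>x\<in>X\<^sub>i. e(x \<bullet> \<xi> / n)\<close>.

  A product \<open>\<sigma>\<^sub>i(\<xi>) \<sigma>\<^sub>j(\<xi>)\<close> is the sum of \<open>e((x + y) \<bullet> \<xi> / n)\<close> over \<open>X\<^sub>i \<times> X\<^sub>j\<close>.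
  Collect the terms with \<open>x + y = z\<close>. The group acts by additive bijections that preserve
  \<open>X\<^sub>i\<close> and \<open>X\<^sub>j\<close>, so the number of such terms is constant as \<open>z\<close> runs through a superclass
  (\<open>num_solutions_constant\<close>), and the sum regroups into the product formula
  (\<open>supercharacter_mult\<close>). Up to the scaling by square roots of orbit sizes, this formula is
  the identity \<open>T\<^sub>i U = U D\<^sub>i\<close>.

  The characters \<open>\<xi> \<mapsto> e(x \<bullet> \<xi> / n)\<close> of distinct \<open>x\<close> are orthogonal, and distinct superclasses
  are disjoint. Hence the supercharacters are orthogonal as functions on the group
  (\<open>supercharacter_orthogonal\<close>). Being constant on superclasses, they can be summed superclass by
  superclass, with weight \<open>card X\<^sub>l\<close>; the square roots in \<open>U\<close> are chosen to absorb these weights,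
  so \<open>U\<close> is unitary (\<open>U_unitary\<close>).

  The rest is linear algebra. From \<open>T\<^sub>i = U D\<^sub>i U\<^sup>*\<close>, each \<open>T\<^sub>i\<close> is normal because diagonal matrices
  commute. Conjugation by \<open>U\<close> identifies the algebra with the diagonal matrices, that is, with
  functions on the set of superclasses. Under this identification \<open>T\<^sub>i\<close> becomes \<open>\<sigma>\<^sub>i\<close>, and the \<open>N\<close>
  functions \<open>\<sigma>\<^sub>i\<close> form a basis because they are, up to nonzero scalings, the rows of an invertible
  matrix (\<open>basis_diagonalized_algebra\<close>, \<open>eigenvalues_complete\<close>).
\<close>

section \<open>Characters of the group of residue vectors\<close>

definition additive_char :: "nat \<Rightarrow> int vec \<Rightarrow> int vec \<Rightarrow> complex" where
  "additive_char n x \<xi> = exp_2pi_i (real_of_int (x \<bullet> \<xi>) / real n)"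

lemma zmod_vecs_carrier: "x \<in> zmod_vecs n d \<Longrightarrow> x \<in> carrier_vec d"
  by (simp add: zmod_vecs_def)

lemma vec_reduce_closed: "n \<ge> 1 \<Longrightarrow> x \<in> carrier_vec d \<Longrightarrow> vec_reduce n x \<in> zmod_vecs n d"
  by (auto simp: vec_reduce_def zmod_vecs_def)

lemma zmod_vecs_eqI:
  assumes "x \<in> zmod_vecs n d" "y \<in> zmod_vecs n d"
    and "\<And>i. i < d \<Longrightarrow> x $ i mod int n = y $ i mod int n"
  shows "x = y"
proof (rule eq_vecI)
  show "dim_vec x = dim_vec y" using assms by (auto simp: zmod_vecs_def)
  fix i assume "i < dim_vec y"
  with assms(2) have i: "i < d" by (auto simp: zmod_vecs_def)
  then have "x $ i mod int n = x $ i" "y $ i mod int n = y $ i"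
    using assms(1,2) by (auto simp: zmod_vecs_def)
  with assms(3)[OF i] show "x $ i = y $ i" by simp
qed

lemma exp_2pi_i_add: "exp_2pi_i (a + b) = exp_2pi_i a * exp_2pi_i b"
  by (simp add: exp_2pi_i_def exp_add [symmetric] algebra_simps)

lemma exp_2pi_i_conv_cis: "exp_2pi_i a = cis (2 * pi * a)"
  by (simp add: exp_2pi_i_def cis_conv_exp mult_ac)

lemma cnj_exp_2pi_i: "cnj (exp_2pi_i a) = exp_2pi_i (- a)"
  by (simp add: exp_2pi_i_conv_cis cis_cnj)

lemma exp_2pi_i_eq_1_imp_int:
  assumes "exp_2pi_i a = 1"
  obtains k :: int where "a = of_int k"
proof -
  from assms have "cos (2 * pi * a) = 1"
    by (metis exp_2pi_i_conv_cis cis.simps(1) one_complex.simps(1))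
  then obtain k :: int where "2 * pi * a = of_int k * 2 * pi"
    by (auto simp: cos_one_2pi_int)
  then have "a = of_int k" by simp
  then show ?thesis by (rule that)
qed

lemma additive_char_add_left:
  assumes "n \<ge> 1" "x \<in> carrier_vec d" "y \<in> carrier_vec d" "\<xi> \<in> carrier_vec d"
  shows "additive_char n (vec_reduce n (x + y)) \<xi> = additive_char n x \<xi> * additive_char n y \<xi>"
proof -
  have "additive_char n (vec_reduce n (x + y)) \<xi> = additive_char n (x + y) \<xi>"
    unfolding additive_char_def
    by (rule exp_2pi_i_cong_mod [OF assms(1)], rule scalar_prod_mod_cong [where d = d])
      (use assms in \<open>auto simp: vec_reduce_def\<close>)
  also have "(x + y) \<bullet> \<xi> = x \<bullet> \<xi> + y \<bullet> \<xi>"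
    using assms by (simp add: add_scalar_prod_distrib)
  then have "additive_char n (x + y) \<xi> = additive_char n x \<xi> * additive_char n y \<xi>"
    by (simp add: additive_char_def add_divide_distrib exp_2pi_i_add)
  finally show ?thesis .
qed

lemma additive_char_commute:
  assumes "x \<in> carrier_vec d" "y \<in> carrier_vec d"
  shows "additive_char n x y = additive_char n y x"
  using assms by (simp add: additive_char_def comm_scalar_prod)

lemma card_zmod_vecs: "card (zmod_vecs n d) = n ^ d"
proof -
  have "bij_betw list_of_vec (zmod_vecs n d) {xs. set xs \<subseteq> {0..<int n} \<and> length xs = d}"
  proof (rule bij_betw_byWitness [where f' = vec_of_list])
    show "list_of_vec ` zmod_vecs n d \<subseteq> {xs. set xs \<subseteq> {0..<int n} \<and> length xs = d}"
      by (auto simp: zmod_vecs_def set_list_of_vec vec_set_def)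
    show "vec_of_list ` {xs. set xs \<subseteq> {0..<int n} \<and> length xs = d} \<subseteq> zmod_vecs n d"
      by (auto simp: zmod_vecs_def vec_of_list_index subset_iff intro!: carrier_vecI)
  qed (auto simp: vec_list list_vec)
  then have "card (zmod_vecs n d) = card {xs. set xs \<subseteq> {0..<int n} \<and> length xs = d}"
    by (rule bij_betw_same_card)
  then show ?thesis by (simp add: card_lists_length_eq)
qed

text \<open>
  If the character of \<open>w\<close> is nontrivial, it takes a value other than 1 at some unit vector;
  translating the summation variable by that vector multiplies the sum by this value.
\<close>
lemma sum_additive_char_eq_0:
  assumes n: "n \<ge> 1" and w: "w \<in> carrier_vec d" and i: "i < d" "w $ i mod int n \<noteq> 0"
  shows "(\<Sum>\<xi>\<in>zmod_vecs n d. additive_char n w \<xi>) = 0"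
proof -
  let ?G = "zmod_vecs n d" and ?u = "unit_vec d i :: int vec"
  let ?shift = "\<lambda>\<xi>. vec_reduce n (\<xi> + ?u)"
  have inj: "inj_on ?shift ?G"
  proof (rule inj_onI, rule zmod_vecs_eqI)
    fix \<xi> \<eta> k assume \<xi>: "\<xi> \<in> ?G" and \<eta>: "\<eta> \<in> ?G" and eq: "?shift \<xi> = ?shift \<eta>" and k: "k < d"
    have "(\<xi> $ k + ?u $ k) mod int n = (\<eta> $ k + ?u $ k) mod int n"
      using arg_cong [OF eq, of "\<lambda>v. v $ k"] k zmod_vecs_carrier [OF \<xi>] zmod_vecs_carrier [OF \<eta>]
      by (simp add: vec_reduce_def)
    then have "(\<xi> $ k + ?u $ k - ?u $ k) mod int n = (\<eta> $ k + ?u $ k - ?u $ k) mod int n"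
      by (rule mod_diff_cong) simp
    then show "\<xi> $ k mod int n = \<eta> $ k mod int n" by simp
  qed auto
  have "?shift ` ?G \<subseteq> ?G"
    using n by (auto intro!: vec_reduce_closed dest: zmod_vecs_carrier)
  then have img: "?shift ` ?G = ?G"
    using inj by (intro endo_inj_surj finite_zmod_vecs)
  have "(\<Sum>\<xi>\<in>?G. additive_char n w \<xi>) = (\<Sum>\<xi>\<in>?G. additive_char n w (?shift \<xi>))"
    using sum.reindex [OF inj, of "additive_char n w"] by (simp add: img)
  also have "\<dots> = (\<Sum>\<xi>\<in>?G. additive_char n w \<xi> * additive_char n w ?u)"
  proof (rule sum.cong [OF refl])
    fix \<xi> assume "\<xi> \<in> ?G"
    then have \<xi>: "\<xi> \<in> carrier_vec d" by (rule zmod_vecs_carrier)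
    have "additive_char n w (?shift \<xi>) = additive_char n (?shift \<xi>) w"
      by (rule additive_char_commute [OF w]) (use \<xi> in \<open>auto simp: vec_reduce_def\<close>)
    then show "additive_char n w (?shift \<xi>) = additive_char n w \<xi> * additive_char n w ?u"
      using additive_char_add_left [OF n \<xi> unit_vec_carrier w]
      by (simp add: additive_char_commute [OF w \<xi>] additive_char_commute [OF w unit_vec_carrier])
  qed
  finally have "(\<Sum>\<xi>\<in>?G. additive_char n w \<xi>) * (1 - additive_char n w ?u) = 0"
    by (simp add: sum_distrib_right [symmetric] algebra_simps)
  moreover have "additive_char n w ?u \<noteq> 1"
  proof
    assume "additive_char n w ?u = 1"
    then have "exp_2pi_i (real_of_int (w $ i) / real n) = 1"
      using w i by (simp add: additive_char_def)
    then obtain k where "real_of_int (w $ i) / real n = of_int k"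
      by (rule exp_2pi_i_eq_1_imp_int)
    then have "real_of_int (w $ i) = real_of_int (k * int n)"
      using n by (simp add: field_simps)
    then have "w $ i = k * int n" by (simp only: of_int_eq_iff)
    with i(2) show False by simp
  qed
  ultimately show ?thesis by simp
qed

lemma additive_char_orthogonal:
  assumes n: "n \<ge> 1" and x: "x \<in> zmod_vecs n d" and y: "y \<in> zmod_vecs n d"
  shows "(\<Sum>\<xi>\<in>zmod_vecs n d. additive_char n x \<xi> * cnj (additive_char n y \<xi>))
    = (if x = y then of_nat (n ^ d) else 0)"
proof -
  note xc = zmod_vecs_carrier [OF x] and yc = zmod_vecs_carrier [OF y]
  have diff: "additive_char n x \<xi> * cnj (additive_char n y \<xi>) = additive_char n (x - y) \<xi>"
    if "\<xi> \<in> zmod_vecs n d" for \<xi>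
  proof -
    have "(x - y) \<bullet> \<xi> = x \<bullet> \<xi> - y \<bullet> \<xi>"
      using xc yc zmod_vecs_carrier [OF that] by (rule minus_scalar_prod_distrib)
    then show ?thesis
      using exp_2pi_i_add [of "real_of_int (x \<bullet> \<xi>) / real n" "- (real_of_int (y \<bullet> \<xi>) / real n)"]
      by (simp add: additive_char_def cnj_exp_2pi_i diff_divide_distrib)
  qed
  have "(\<Sum>\<xi>\<in>zmod_vecs n d. additive_char n x \<xi> * cnj (additive_char n y \<xi>))
    = (\<Sum>\<xi>\<in>zmod_vecs n d. additive_char n (x - y) \<xi>)"
    by (rule sum.cong [OF refl diff])
  also have "\<dots> = (if x = y then of_nat (n ^ d) else 0)"
  proof (cases "x = y")
    case True
    have "additive_char n (x - y) \<xi> = 1" if "\<xi> \<in> zmod_vecs n d" for \<xi>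
      using diff [OF that] exp_2pi_i_add [of "real_of_int (x \<bullet> \<xi>) / real n" "- (real_of_int (x \<bullet> \<xi>) / real n)"]
      by (simp add: True additive_char_def cnj_exp_2pi_i) (simp add: exp_2pi_i_def)
    then show ?thesis using True by (simp add: card_zmod_vecs)
  next
    case False
    then obtain i where i: "i < d" "x $ i mod int n \<noteq> y $ i mod int n"
      using zmod_vecs_eqI [OF x y] by blast
    then have "(x - y) $ i mod int n \<noteq> 0"
      using xc yc by (simp add: mod_eq_dvd_iff mod_eq_0_iff_dvd)
    then show ?thesis
      using sum_additive_char_eq_0 [OF n _ i(1), of "x - y"] xc yc False by simp
  qed
  finally show ?thesis .
qed

section \<open>Superclasses as orbits of a symmetric matrix group\<close>

lemma mat_reduce_carrier:
  assumes "n \<ge> 1" "A \<in> carrier_mat d d"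
  shows "mat_reduce n A \<in> carrier (zmod_mat_monoid n d)"
  using assms by (auto simp: zmod_mat_monoid_def mat_reduce_def)

lemma mat_reduce_mult:
  assumes "A \<in> carrier_mat d d" "B \<in> carrier_mat d d"
  shows "mat_reduce n (mat_reduce n A * B) = mat_reduce n (A * B)"
    and "mat_reduce n (A * mat_reduce n B) = mat_reduce n (A * B)"
proof -
  show "mat_reduce n (mat_reduce n A * B) = mat_reduce n (A * B)"
    by (rule eq_matI)
      (use assms in \<open>auto simp: mat_reduce_def intro!: scalar_prod_mod_cong [where d = d]\<close>)
  show "mat_reduce n (A * mat_reduce n B) = mat_reduce n (A * B)"
    by (rule eq_matI)
      (use assms in \<open>auto simp: mat_reduce_def intro!: scalar_prod_mod_cong [where d = d]\<close>)
qed

text \<open>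
  Reversing the action of a group element requires inverses in \<open>GL n d\<close>, which exist because
  matrices modulo \<open>n\<close> form a monoid.
\<close>
lemma monoid_zmod_mat_monoid:
  assumes n: "n \<ge> 1"
  shows "Group.monoid (zmod_mat_monoid n d)"
proof -
  let ?M = "zmod_mat_monoid n d"
  have car: "A \<in> carrier_mat d d" and red: "mat_reduce n A = A" if "A \<in> carrier ?M" for A
    using that by (auto simp: zmod_mat_monoid_def mat_reduce_def intro!: eq_matI)
  have mult: "A \<otimes>\<^bsub>?M\<^esub> B = mat_reduce n (A * B)" and one: "\<one>\<^bsub>?M\<^esub> = mat_reduce n (1\<^sub>m d)" for A B
    by (simp_all add: zmod_mat_monoid_def)
  show ?thesis
  proof (rule Group.monoidI)
    show "A \<otimes>\<^bsub>?M\<^esub> B \<in> carrier ?M" if "A \<in> carrier ?M" "B \<in> carrier ?M" for A B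
      unfolding mult using that by (intro mat_reduce_carrier n mult_carrier_mat [of _ d d] car)
    show "\<one>\<^bsub>?M\<^esub> \<in> carrier ?M"
      unfolding one by (intro mat_reduce_carrier n one_carrier_mat)
    show "A \<otimes>\<^bsub>?M\<^esub> B \<otimes>\<^bsub>?M\<^esub> C = A \<otimes>\<^bsub>?M\<^esub> (B \<otimes>\<^bsub>?M\<^esub> C)"
      if "A \<in> carrier ?M" "B \<in> carrier ?M" "C \<in> carrier ?M" for A B C
      using car [OF that(1)] car [OF that(2)] car [OF that(3)]
      by (simp add: mult mat_reduce_mult [where d = d])
    show "\<one>\<^bsub>?M\<^esub> \<otimes>\<^bsub>?M\<^esub> A = A" if "A \<in> carrier ?M" for A
      using car [OF that] red [OF that] by (simp add: mult one mat_reduce_mult [where d = d])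
    show "A \<otimes>\<^bsub>?M\<^esub> \<one>\<^bsub>?M\<^esub> = A" if "A \<in> carrier ?M" for A
      using car [OF that] red [OF that] by (simp add: mult one mat_reduce_mult [where d = d])
  qed
qed

lemma group_GL: "n \<ge> 1 \<Longrightarrow> Group.group (GL n d)"
  unfolding GL_def by (intro monoid.units_group monoid_zmod_mat_monoid)

lemma mat_action_add:
  assumes A: "A \<in> carrier_mat d d" and x: "x \<in> carrier_vec d" and y: "y \<in> carrier_vec d"
  shows "mat_action n A (vec_reduce n (x + y)) = vec_reduce n (mat_action n A x + mat_action n A y)"
proof (rule eq_vecI)
  show "dim_vec (mat_action n A (vec_reduce n (x + y)))
      = dim_vec (vec_reduce n (mat_action n A x + mat_action n A y))"
    by (simp add: mat_action_def vec_reduce_def)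
  fix i assume "i < dim_vec (vec_reduce n (mat_action n A x + mat_action n A y))"
  then have i: "i < d" using A by (simp add: mat_action_def vec_reduce_def)
  have "mat_action n A (vec_reduce n (x + y)) $ i = (row A i \<bullet> vec_reduce n (x + y)) mod int n"
    using i A by (simp add: mat_action_def vec_reduce_def)
  also have "\<dots> = (row A i \<bullet> (x + y)) mod int n"
    by (rule scalar_prod_mod_cong [where d = d]) (use i A x y in \<open>auto simp: vec_reduce_def\<close>)
  also have "row A i \<bullet> (x + y) = row A i \<bullet> x + row A i \<bullet> y"
    using i A x y by (intro scalar_prod_add_distrib) auto
  also have "\<dots> mod int n = vec_reduce n (mat_action n A x + mat_action n A y) $ i"
    using i A by (simp add: mat_action_def vec_reduce_def mod_add_eq)
  finally show "mat_action n A (vec_reduce n (x + y)) $ i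
      = vec_reduce n (mat_action n A x + mat_action n A y) $ i" .
qed

locale symmetric_matrix_group =
  fixes n d :: nat and \<Gamma> :: "int mat set"
  assumes n_pos: "n \<ge> 1"
    and subgroup: "subgroup \<Gamma> (GL n d)"
    and symmetric: "\<Gamma> = transpose_mat ` \<Gamma>"
begin

abbreviation "G \<equiv> zmod_vecs n d"
abbreviation "SC \<equiv> superclasses n d \<Gamma>"
abbreviation "\<sigma> \<equiv> supercharacter n"

lemma matrix_carrier: "A \<in> \<Gamma> \<Longrightarrow> A \<in> carrier_mat d d"
  by (meson GL_carrierD subgroup subgroup.mem_carrier)

lemma mult_closed: "A \<in> \<Gamma> \<Longrightarrow> B \<in> \<Gamma> \<Longrightarrow> mat_reduce n (A * B) \<in> \<Gamma>"
  using subgroup.m_closed [OF subgroup] by (simp add: GL_simps)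

lemma one_closed: "mat_reduce n (1\<^sub>m d) \<in> \<Gamma>"
  using subgroup.one_closed [OF subgroup] by (simp add: GL_simps)

lemma inverse_action:
  assumes "A \<in> \<Gamma>"
  obtains B where "B \<in> \<Gamma>" "\<And>y. y \<in> G \<Longrightarrow> mat_action n B (mat_action n A y) = y"
proof -
  interpret group "GL n d" by (rule group_GL [OF n_pos])
  let ?B = "inv\<^bsub>GL n d\<^esub> A"
  have B: "?B \<in> \<Gamma>" using assms subgroup by (simp add: subgroup.m_inv_closed)
  have "mat_reduce n (?B * A) = mat_reduce n (1\<^sub>m d)"
    using l_inv [of A] subgroup.mem_carrier [OF subgroup assms] by (simp add: GL_simps)
  then have "mat_action n ?B (mat_action n A y) = y" if "y \<in> G" for y
    using mat_action_mult [OF matrix_carrier [OF B] matrix_carrier [OF assms] zmod_vecs_carrier [OF that], of n]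
      mat_action_one [OF that] by simp
  with B show ?thesis by (rule that)
qed

lemma mat_action_inj_on: "A \<in> \<Gamma> \<Longrightarrow> inj_on (mat_action n A) G"
  by (metis inverse_action inj_on_inverseI)

lemma superclass_iff: "Y \<in> SC \<longleftrightarrow> (\<exists>y\<in>G. Y = (\<lambda>A. mat_action n A y) ` \<Gamma>)"
  by (auto simp: superclasses_def orbits_def orbit_def image_def Bex_def)

lemma superclass_subset: "Y \<in> SC \<Longrightarrow> Y \<subseteq> G"
  using mat_action_closed [OF n_pos matrix_carrier] by (auto simp: superclass_iff)

lemma finite_superclass: "Y \<in> SC \<Longrightarrow> finite Y"
  using superclass_subset finite_zmod_vecs by (rule finite_subset)

lemma superclass_nonempty: "Y \<in> SC \<Longrightarrow> Y \<noteq> {}"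
  using one_closed by (auto simp: superclass_iff)

lemma superclass_eq_orbit:
  assumes "Y \<in> SC" "y \<in> Y"
  shows "Y = (\<lambda>A. mat_action n A y) ` \<Gamma>"
proof -
  obtain y0 A where y0: "y0 \<in> G" "Y = (\<lambda>A. mat_action n A y0) ` \<Gamma>"
    and A: "A \<in> \<Gamma>" "y = mat_action n A y0"
    using assms by (auto simp: superclass_iff)
  obtain B where B: "B \<in> \<Gamma>" "mat_action n B y = y0"
    using inverse_action [OF A(1)] y0(1) A(2) by metis
  have y: "y \<in> G" using assms superclass_subset by blast
  have compose: "mat_action n C (mat_action n D z) \<in> (\<lambda>A. mat_action n A z) ` \<Gamma>"
    if "C \<in> \<Gamma>" "D \<in> \<Gamma>" "z \<in> G" for C D z
    using mat_action_mult [OF matrix_carrier [OF that(1)] matrix_carrier [OF that(2)] zmod_vecs_carrier [OF that(3)], of n]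
      mult_closed [OF that(1,2)] by (metis imageI)
  show ?thesis
    unfolding y0(2) using compose [OF _ B(1) y] compose [OF _ A(1) y0(1)]
    by (auto simp: B(2) A(2) [symmetric])
qed

lemma superclass_closed: "Y \<in> SC \<Longrightarrow> A \<in> \<Gamma> \<Longrightarrow> y \<in> Y \<Longrightarrow> mat_action n A y \<in> Y"
  using superclass_eq_orbit by blast

lemma superclasses_disjoint: "Y \<in> SC \<Longrightarrow> Z \<in> SC \<Longrightarrow> Y \<noteq> Z \<Longrightarrow> Y \<inter> Z = {}"
  using superclass_eq_orbit by blast

lemma Union_superclasses: "\<Union>SC = G"
proof
  show "\<Union>SC \<subseteq> G" using superclass_subset by blast
  show "G \<subseteq> \<Union>SC"
  proof
    fix y assume y: "y \<in> G"
    then have "y \<in> (\<lambda>A. mat_action n A y) ` \<Gamma>"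
      using one_closed mat_action_one [OF y] by force
    moreover have "(\<lambda>A. mat_action n A y) ` \<Gamma> \<in> SC" using y superclass_iff by blast
    ultimately show "y \<in> \<Union>SC" by blast
  qed
qed

lemma sum_over_superclasses: "(\<Sum>z\<in>G. f z) = (\<Sum>Z\<in>SC. \<Sum>z\<in>Z. f z)"
  using sum.Union_disjoint [of SC f] finite_superclass superclasses_disjoint
  by (simp add: Union_superclasses)

lemma supercharacter_value:
  "Y \<in> SC \<Longrightarrow> Z \<in> SC \<Longrightarrow> \<xi> \<in> Z \<Longrightarrow> supercharacter_value n Y Z = \<sigma> Y \<xi>"
  by (rule supercharacter_value_eq [OF n_pos subgroup symmetric])

section \<open>The structure constants and the product formula\<close>

text \<open>
  Acting by \<open>A\<close> on both summands maps the solutions for \<open>z\<close> injectively to solutions for \<open>A z\<close>.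
  The inequality suffices for constancy on an orbit, since any two points of an orbit can
  be moved to each other.
\<close>
lemma num_solutions_mono:
  assumes Y: "Y \<in> SC" and Z: "Z \<in> SC" and A: "A \<in> \<Gamma>"
  shows "num_solutions n Y Z z \<le> num_solutions n Y Z (mat_action n A z)"
proof -
  let ?sols = "\<lambda>z. {(x, y) \<in> Y \<times> Z. vec_reduce n (x + y) = z}"
  let ?a = "map_prod (mat_action n A) (mat_action n A)"
  have sub: "?sols z \<subseteq> G \<times> G"
    using superclass_subset [OF Y] superclass_subset [OF Z] by blast
  have "card (?sols z) \<le> card (?sols (mat_action n A z))"
  proof (rule card_inj_on_le)
    show "inj_on ?a (?sols z)"
      using map_prod_inj_on [OF mat_action_inj_on [OF A] mat_action_inj_on [OF A]] sub
      by (rule inj_on_subset)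
    show "?a ` ?sols z \<subseteq> ?sols (mat_action n A z)"
    proof (clarsimp, intro conjI)
      fix x y assume xy: "x \<in> Y" "y \<in> Z"
      then show "mat_action n A x \<in> Y" "mat_action n A y \<in> Z"
        using superclass_closed [OF Y A] superclass_closed [OF Z A] by auto
      have "x \<in> carrier_vec d" "y \<in> carrier_vec d"
        using xy superclass_subset [OF Y] superclass_subset [OF Z] zmod_vecs_carrier by blast+
      then show "vec_reduce n (mat_action n A x + mat_action n A y)
          = mat_action n A (vec_reduce n (x + y))"
        by (rule mat_action_add [OF matrix_carrier [OF A], symmetric])
    qed
    show "finite (?sols (mat_action n A z))"
      by (rule finite_subset [of _ "Y \<times> Z"]) (use finite_superclass Y Z in auto)
  qed
  then show ?thesis by (simp add: num_solutions_def)
qed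

lemma num_solutions_constant:
  assumes "Y \<in> SC" "Z \<in> SC" "W \<in> SC" "z \<in> W" "z' \<in> W"
  shows "num_solutions n Y Z z = num_solutions n Y Z z'"
proof -
  obtain A B where "A \<in> \<Gamma>" "z' = mat_action n A z" "B \<in> \<Gamma>" "z = mat_action n B z'"
    using superclass_eq_orbit assms by blast
  then show ?thesis
    using num_solutions_mono [OF assms(1,2)] by (metis antisym)
qed

lemma structure_const_eq:
  assumes "Y \<in> SC" "Z \<in> SC" "W \<in> SC" "z \<in> W"
  shows "structure_const n Y Z W = num_solutions n Y Z z"
  unfolding structure_const_def
proof (rule the_equality)
  show "\<forall>w\<in>W. num_solutions n Y Z w = num_solutions n Y Z z"
    using num_solutions_constant [OF assms(1-3) _ assms(4)] by blast
  then show "c = num_solutions n Y Z z" if "\<forall>w\<in>W. num_solutions n Y Z w = c" for c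
    using that assms(4) by simp
qed

text \<open>
  The product of two character sums is a sum over pairs \<open>(x, y)\<close>, grouped first by the value
  of \<open>x + y\<close> and then by the superclass of that value.
\<close>
lemma supercharacter_mult:
  assumes Y: "Y \<in> SC" and Z: "Z \<in> SC" and \<xi>: "\<xi> \<in> G"
  shows "\<sigma> Y \<xi> * \<sigma> Z \<xi> = (\<Sum>W\<in>SC. of_nat (structure_const n Y Z W) * \<sigma> W \<xi>)"
proof -
  let ?add = "\<lambda>p. vec_reduce n (fst p + snd p)"
  have cv: "x \<in> carrier_vec d" if "x \<in> Y \<or> x \<in> Z" for x
    using that superclass_subset [OF Y] superclass_subset [OF Z] zmod_vecs_carrier by blast
  have "\<sigma> Y \<xi> * \<sigma> Z \<xi> = (\<Sum>x\<in>Y. \<Sum>y\<in>Z. additive_char n x \<xi> * additive_char n y \<xi>)"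
    by (simp add: supercharacter_def additive_char_def sum_product)
  also have "\<dots> = (\<Sum>p\<in>Y \<times> Z. additive_char n (?add p) \<xi>)"
    unfolding sum.cartesian_product
    by (rule sum.cong [OF refl])
      (auto simp: additive_char_add_left [OF n_pos _ _ zmod_vecs_carrier [OF \<xi>]] cv)
  also have "\<dots> = (\<Sum>z\<in>G. \<Sum>p | p \<in> Y \<times> Z \<and> ?add p = z. additive_char n (?add p) \<xi>)"
    by (rule sum.group [symmetric])
      (use finite_superclass Y Z finite_zmod_vecs cv n_pos in \<open>auto intro!: vec_reduce_closed\<close>)
  also have "\<dots> = (\<Sum>z\<in>G. of_nat (num_solutions n Y Z z) * additive_char n z \<xi>)"
  proof (rule sum.cong [OF refl])
    fix z
    have "{(x, y) \<in> Y \<times> Z. vec_reduce n (x + y) = z} = {p \<in> Y \<times> Z. ?add p = z}" by auto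
    then show "(\<Sum>p | p \<in> Y \<times> Z \<and> ?add p = z. additive_char n (?add p) \<xi>)
        = of_nat (num_solutions n Y Z z) * additive_char n z \<xi>"
      by (simp add: num_solutions_def)
  qed
  also have "\<dots> = (\<Sum>W\<in>SC. \<Sum>z\<in>W. of_nat (num_solutions n Y Z z) * additive_char n z \<xi>)"
    by (rule sum_over_superclasses)
  also have "\<dots> = (\<Sum>W\<in>SC. of_nat (structure_const n Y Z W) * \<sigma> W \<xi>)"
    by (rule sum.cong [OF refl])
      (simp add: structure_const_eq [OF Y Z] supercharacter_def additive_char_def sum_distrib_left)
  finally show ?thesis .
qed

section \<open>Orthogonality of the supercharacters\<close>

text \<open>
  The weights \<open>card W\<close> turn the sum over superclasses into one over the whole group. There the
  orthogonality of characters leaves only the pairs \<open>x = y\<close>, and these exist only if the two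
  superclasses coincide.
\<close>
lemma supercharacter_orthogonal:
  assumes Y: "Y \<in> SC" and Z: "Z \<in> SC"
  shows "(\<Sum>W\<in>SC. of_nat (card W) * (supercharacter_value n Y W * cnj (supercharacter_value n Z W)))
    = (if Y = Z then of_nat (n ^ d * card Y) else 0)"
proof -
  have "(\<Sum>W\<in>SC. of_nat (card W) * (supercharacter_value n Y W * cnj (supercharacter_value n Z W)))
      = (\<Sum>W\<in>SC. \<Sum>\<xi>\<in>W. \<sigma> Y \<xi> * cnj (\<sigma> Z \<xi>))"
    by (rule sum.cong [OF refl])
      (simp add: supercharacter_value [OF Y, symmetric] supercharacter_value [OF Z, symmetric])
  also have "\<dots> = (\<Sum>\<xi>\<in>G. \<sigma> Y \<xi> * cnj (\<sigma> Z \<xi>))"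
    by (rule sum_over_superclasses [symmetric])
  also have "\<dots> = (\<Sum>\<xi>\<in>G. \<Sum>x\<in>Y. \<Sum>y\<in>Z. additive_char n x \<xi> * cnj (additive_char n y \<xi>))"
    by (simp add: supercharacter_def additive_char_def sum_product)
  also have "\<dots> = (\<Sum>x\<in>Y. \<Sum>y\<in>Z. \<Sum>\<xi>\<in>G. additive_char n x \<xi> * cnj (additive_char n y \<xi>))"
    by (subst sum.swap, intro sum.cong refl sum.swap)
  also have "\<dots> = (\<Sum>x\<in>Y. \<Sum>y\<in>Z. if x = y then of_nat (n ^ d) else 0)"
    using superclass_subset [OF Y] superclass_subset [OF Z]
    by (intro sum.cong refl additive_char_orthogonal n_pos) auto
  also have "\<dots> = (\<Sum>x\<in>Y. if x \<in> Z then of_nat (n ^ d) else 0)"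
    using finite_superclass [OF Z] by (intro sum.cong refl) simp
  also have "\<dots> = (if Y = Z then of_nat (n ^ d * card Y) else 0)"
  proof (cases "Y = Z")
    case False
    then have "x \<notin> Z" if "x \<in> Y" for x using that superclasses_disjoint [OF Y Z] by blast
    with False show ?thesis by simp
  qed simp
  finally show ?thesis .
qed

end


section \<open>Families of matrices diagonalised by one unitary matrix\<close>

lemma mat_adjoint_dim [simp]:
  "dim_row (mat_adjoint A) = dim_col A" "dim_col (mat_adjoint A) = dim_row A"
  by (simp_all add: mat_adjoint_def)

lemma mat_adjoint_carrier: "A \<in> carrier_mat m k \<Longrightarrow> mat_adjoint A \<in> carrier_mat k m"
  by auto

lemma mat_adjoint_index:
  assumes "i < dim_col A" "j < dim_row A"
  shows "mat_adjoint A $$ (i, j) = conjugate (A $$ (j, i))"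
  using assms by (simp add: mat_adjoint_def mat_of_rows_index)

lemma mat_adjoint_adjoint: "mat_adjoint (mat_adjoint A) = (A :: complex mat)"
  by (rule eq_matI) (simp_all add: mat_adjoint_index)

lemma mat_adjoint_mult:
  fixes A B :: "complex mat"
  assumes "A \<in> carrier_mat m k" "B \<in> carrier_mat k l"
  shows "mat_adjoint (A * B) = mat_adjoint B * mat_adjoint A"
proof (rule eq_matI)
  note dims = mat_adjoint_carrier [OF assms(1)] mat_adjoint_carrier [OF assms(2)]
  show "dim_row (mat_adjoint (A * B)) = dim_row (mat_adjoint B * mat_adjoint A)"
    and "dim_col (mat_adjoint (A * B)) = dim_col (mat_adjoint B * mat_adjoint A)"
    using assms by auto
  fix i j assume "i < dim_row (mat_adjoint B * mat_adjoint A)" "j < dim_col (mat_adjoint B * mat_adjoint A)"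
  with assms dims show "mat_adjoint (A * B) $$ (i, j) = (mat_adjoint B * mat_adjoint A) $$ (i, j)"
    by (auto simp: mat_adjoint_index scalar_prod_def mult.commute)
qed

lemma mat_adjoint_diag: "mat_adjoint (mat_diag N f) = mat_diag N (\<lambda>l. cnj (f l))"
  by (rule eq_matI) (auto simp: mat_adjoint_index mat_diag_def)

locale unitary_mat =
  fixes N :: nat and U :: "complex mat"
  assumes carrier: "U \<in> carrier_mat N N"
    and mult_adjoint: "U * mat_adjoint U = 1\<^sub>m N"
begin

lemma adjoint_carrier: "mat_adjoint U \<in> carrier_mat N N"
  by (rule mat_adjoint_carrier [OF carrier])

lemma adjoint_mult: "mat_adjoint U * U = 1\<^sub>m N"
  by (rule mat_mult_left_right_inverse [OF carrier adjoint_carrier mult_adjoint])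

lemma mult_right_cancel:
  assumes "A \<in> carrier_mat N N" "B \<in> carrier_mat N N" "A * U = B * U"
  shows "A = B"
proof -
  have "A * U * mat_adjoint U = B * U * mat_adjoint U" using assms(3) by simp
  then show ?thesis
    using assms(1,2) by (simp add: assoc_mult_mat [OF _ carrier adjoint_carrier] mult_adjoint)
qed

lemma mult_left_cancel:
  assumes "A \<in> carrier_mat N N" "B \<in> carrier_mat N N" "U * A = U * B"
  shows "A = B"
proof -
  have "mat_adjoint U * U * A = mat_adjoint U * U * B"
    using assms by (simp add: assoc_mult_mat [OF adjoint_carrier carrier])
  then show ?thesis using assms(1,2) by (simp add: adjoint_mult)
qed

lemma conjugated_diag_iff:
  assumes T: "T \<in> carrier_mat N N"
  shows "T * U = U * mat_diag N f \<longleftrightarrow> T = U * mat_diag N f * mat_adjoint U"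
proof
  assume "T * U = U * mat_diag N f"
  then have "T * U * mat_adjoint U = U * mat_diag N f * mat_adjoint U" by simp
  then show "T = U * mat_diag N f * mat_adjoint U"
    using T by (simp add: assoc_mult_mat [OF _ carrier adjoint_carrier] mult_adjoint)
next
  have UD: "U * mat_diag N f \<in> carrier_mat N N" using carrier by simp
  assume "T = U * mat_diag N f * mat_adjoint U"
  then show "T * U = U * mat_diag N f"
    by (simp add: assoc_mult_mat [OF UD adjoint_carrier carrier] adjoint_mult right_mult_one_mat [OF UD])
qed

lemma conjugated_diag_mult:
  "(U * mat_diag N f * mat_adjoint U) * (U * mat_diag N g * mat_adjoint U)
    = U * mat_diag N (\<lambda>l. f l * g l) * mat_adjoint U"
proof -
  let ?V = "mat_adjoint U" and ?F = "mat_diag N f" and ?H = "mat_diag N g"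
  have UF: "U * ?F \<in> carrier_mat N N" and HV: "?H * ?V \<in> carrier_mat N N"
    using mult_carrier_mat [OF carrier, of "?F" N] mult_carrier_mat [OF _ adjoint_carrier, of "?H" N]
    by simp_all
  have "(U * ?F * ?V) * (U * ?H * ?V) = U * ?F * (?V * (U * (?H * ?V)))"
    unfolding assoc_mult_mat [OF carrier mat_diag_dim adjoint_carrier, of g]
    by (rule assoc_mult_mat [OF UF adjoint_carrier mult_carrier_mat [OF carrier HV]])
  also have "?V * (U * (?H * ?V)) = ?H * ?V"
    by (simp add: assoc_mult_mat [OF adjoint_carrier carrier HV, symmetric] adjoint_mult
        left_mult_one_mat [OF HV])
  also have "U * ?F * (?H * ?V) = U * (?F * ?H) * ?V"
    using assoc_mult_mat [OF carrier mat_diag_dim HV, of f]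
      assoc_mult_mat [OF mat_diag_dim mat_diag_dim adjoint_carrier, of f g]
      assoc_mult_mat [OF carrier mult_carrier_mat [OF mat_diag_dim mat_diag_dim] adjoint_carrier, of f g]
    by (simp del: mat_diag_diag)
  finally show ?thesis by simp
qed

lemma adjoint_conjugated_diag:
  "mat_adjoint (U * mat_diag N f * mat_adjoint U) = U * mat_diag N (\<lambda>l. cnj (f l)) * mat_adjoint U"
proof -
  have UD: "U * mat_diag N f \<in> carrier_mat N N" and
    D: "mat_diag N (\<lambda>l. cnj (f l)) \<in> carrier_mat N N" using carrier by auto
  show ?thesis
    using assoc_mult_mat [OF carrier D adjoint_carrier]
    by (simp add: mat_adjoint_mult [OF UD adjoint_carrier] mat_adjoint_mult [OF carrier, of _ N]
        mat_adjoint_adjoint mat_adjoint_diag)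
qed

lemma normal_if_diagonalized:
  assumes "T \<in> carrier_mat N N" "T * U = U * mat_diag N f"
  shows "mat_adjoint T * T = T * mat_adjoint T"
proof -
  have "T = U * mat_diag N f * mat_adjoint U"
    using assms conjugated_diag_iff by blast
  then show ?thesis
    by (simp only: adjoint_conjugated_diag conjugated_diag_mult mult.commute)
qed

text \<open>
  This form of membership avoids the adjoint: the columns of \<open>U\<close> are eigenvectors of \<open>T\<close>.
\<close>
lemma carrier_diagonalized_algebra_iff:
  "T \<in> carrier (diagonalized_algebra N U)
    \<longleftrightarrow> T \<in> carrier_mat N N \<and> (\<exists>f. T * U = U * mat_diag N f)"
proof (cases "T \<in> carrier_mat N N")
  case True
  let ?D = "mat_adjoint U * T * U"
  have D: "?D \<in> carrier_mat N N" using True carrier adjoint_carrier by simp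
  have TU: "T * U \<in> carrier_mat N N" using True carrier by simp
  have UD: "U * ?D = T * U"
    using True by (simp add: assoc_mult_mat [OF adjoint_carrier True carrier]
        assoc_mult_mat [OF carrier adjoint_carrier TU, symmetric] mult_adjoint left_mult_one_mat [OF TU])
  have "diagonal_mat ?D \<longleftrightarrow> (\<exists>f. ?D = mat_diag N f)"
  proof
    assume "diagonal_mat ?D"
    then have "?D $$ (i, j) = 0" if "i < N" "j < N" "i \<noteq> j" for i j
      using D that unfolding diagonal_mat_def by (metis carrier_matD)
    then have "?D = mat_diag N (\<lambda>l. ?D $$ (l, l))"
      using D by (intro eq_matI) (auto simp: mat_diag_def simp del: index_mult_mat(1))
    then show "\<exists>f. ?D = mat_diag N f" by blast
  next
    assume "\<exists>f. ?D = mat_diag N f"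
    then obtain f where "?D = mat_diag N f" ..
    then show "diagonal_mat ?D" by (simp only:) (simp add: diagonal_mat_def mat_diag_def)
  qed
  also have "\<dots> \<longleftrightarrow> (\<exists>f. T * U = U * mat_diag N f)"
    using mult_left_cancel [OF D] UD by (metis mat_diag_dim)
  finally show ?thesis using True by (simp add: diagonalized_algebra_def)
qed (simp add: diagonalized_algebra_def)

lemma finsum_diagonalized_algebra_index:
  assumes "finite A" "g \<in> A \<rightarrow> carrier (diagonalized_algebra N U)" "j < N" "k < N"
  shows "finsum (diagonalized_algebra N U) g A $$ (j, k) = (\<Sum>M\<in>A. g M $$ (j, k))"
proof -
  interpret vectorspace class_ring "diagonalized_algebra N U"
    by (rule vectorspace_diagonalized_algebra [OF carrier])
  show ?thesis
    using assms(1,2)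
  proof (induction A rule: finite_induct)
    case empty
    have "\<zero>\<^bsub>diagonalized_algebra N U\<^esub> = 0\<^sub>m N N"
      by (simp add: diagonalized_algebra_def module_mat_simps)
    then show ?case using assms(3,4) by (simp add: finsum_empty)
  next
    case (insert M A)
    have "finsum (diagonalized_algebra N U) g A \<in> carrier (diagonalized_algebra N U)"
      using insert.prems by (intro finsum_closed) auto
    then have "finsum (diagonalized_algebra N U) g A \<in> carrier_mat N N"
      by (simp add: carrier_diagonalized_algebra_iff)
    moreover have "finsum (diagonalized_algebra N U) g (insert M A)
        = g M + finsum (diagonalized_algebra N U) g A"
      using insert by (subst finsum_insert) (auto simp: diagonalized_algebra_def module_mat_simps)
    ultimately show ?case using insert assms(3,4) by auto
  qed
qed

text \<open>
  A matrix in the algebra is determined by its eigenvalues on the columns of \<open>U\<close>, and these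
  depend linearly on the matrix. So a family of matrices is a basis of the algebra as soon as its
  eigenvalue vectors form a basis of the space of functions on \<open>{..<N}\<close>. This last property is
  expressed by the hypotheses \<open>span\<close> and \<open>indep\<close>.
\<close>
lemma basis_diagonalized_algebra:
  fixes T :: "nat \<Rightarrow> complex mat" and s :: "nat \<Rightarrow> nat \<Rightarrow> complex"
  assumes T: "\<And>i. i < N \<Longrightarrow> T i \<in> carrier_mat N N"
    and diag: "\<And>i. i < N \<Longrightarrow> T i * U = U * mat_diag N (s i)"
    and span: "\<And>f. \<exists>a. \<forall>l<N. (\<Sum>i<N. a i * s i l) = f l"
    and indep: "\<And>a i. \<forall>l<N. (\<Sum>i<N. a i * s i l) = 0 \<Longrightarrow> i < N \<Longrightarrow> a i = 0"
  shows "inj_on T {..<N}"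
    and "vectorspace.basis class_ring (diagonalized_algebra N U) (T ` {..<N})"
proof -
  let ?V = "diagonalized_algebra N U" and ?S = "T ` {..<N}"
  interpret vectorspace class_ring ?V
    by (rule vectorspace_diagonalized_algebra [OF carrier])
  have diag_cancel: "f l = g l" if eq: "U * mat_diag N f = U * mat_diag N g" and l: "l < N" for f g l
  proof -
    have "mat_diag N f = mat_diag N g" by (rule mult_left_cancel [OF _ _ eq]) simp_all
    then have "mat_diag N f $$ (l, l) = mat_diag N g $$ (l, l)" by simp
    with l show ?thesis by (simp add: mat_diag_def)
  qed
  show inj: "inj_on T {..<N}"
  proof (rule inj_onI, rule ccontr)
    fix i j assume ij: "i \<in> {..<N}" "j \<in> {..<N}" "T i = T j" "i \<noteq> j"
    \<comment> \<open>Equal matrices would have equal eigenvalues, hence give a nontrivial relation.\<close>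
    define a :: "nat \<Rightarrow> complex" where "a m = of_bool (m = i) - of_bool (m = j)" for m
    have "\<forall>l<N. (\<Sum>m<N. a m * s m l) = 0"
    proof (intro allI impI)
      fix l assume "l < N"
      have "s i l = s j l" using diag_cancel \<open>l < N\<close> diag ij by (metis lessThan_iff)
      then show "(\<Sum>m<N. a m * s m l) = 0"
        using ij by (simp add: a_def left_diff_distrib sum_subtractf of_bool_def
            if_distrib [of "\<lambda>x. x * _"] cong: if_cong)
    qed
    from indep [OF this, of i] ij show False by (simp add: a_def)
  qed
  have S: "?S \<subseteq> carrier ?V"
    using T diag by (auto simp: carrier_diagonalized_algebra_iff)
  have smult: "c \<odot>\<^bsub>?V\<^esub> M = c \<cdot>\<^sub>m M" for c M
    by (simp add: diagonalized_algebra_def module_mat_simps)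
  have K: "carrier (class_ring :: complex ring) = UNIV" "\<zero>\<^bsub>(class_ring :: complex ring)\<^esub> = 0"
    by (simp_all add: class_ring_simps)
  have lincomb_carrier: "lincomb a ?S \<in> carrier_mat N N" for a
    using lincomb_closed [OF S, of a] by (simp add: K carrier_diagonalized_algebra_iff)
  have lincomb_mult_U: "lincomb a ?S * U = U * mat_diag N (\<lambda>l. \<Sum>i<N. a (T i) * s i l)" for a
  proof (rule eq_matI)
    have lincomb_index: "lincomb a ?S $$ (j, k) = (\<Sum>i<N. a (T i) * T i $$ (j, k))" if "j < N" "k < N" for j k
    proof -
      have "a M \<cdot>\<^sub>m M \<in> carrier ?V" if "M \<in> ?S" for M
        using smult_closed [of "a M" M] subsetD [OF S that] by (simp only: K smult UNIV_I)
      then have "(\<lambda>M. a M \<cdot>\<^sub>m M) \<in> ?S \<rightarrow> carrier ?V" by (rule Pi_I)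
      then have "lincomb a ?S $$ (j, k) = (\<Sum>M\<in>?S. (a M \<cdot>\<^sub>m M) $$ (j, k))"
        unfolding lincomb_def smult using that
        by (intro finsum_diagonalized_algebra_index finite_imageI finite_lessThan)
      also have "\<dots> = (\<Sum>i<N. (a (T i) \<cdot>\<^sub>m T i) $$ (j, k))"
        by (simp add: sum.reindex [OF inj])
      also have "\<dots> = (\<Sum>i<N. a (T i) * T i $$ (j, k))"
        by (rule sum.cong [OF refl]) (use that in \<open>simp add: carrier_matD [OF T]\<close>)
      finally show ?thesis .
    qed
    show "dim_row (lincomb a ?S * U) = dim_row (U * mat_diag N (\<lambda>l. \<Sum>i<N. a (T i) * s i l))"
      and "dim_col (lincomb a ?S * U) = dim_col (U * mat_diag N (\<lambda>l. \<Sum>i<N. a (T i) * s i l))"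
      by (simp_all add: carrier_matD [OF carrier] carrier_matD [OF lincomb_carrier] mat_diag_def)
    fix j l assume "j < dim_row (U * mat_diag N (\<lambda>l. \<Sum>i<N. a (T i) * s i l))"
      and "l < dim_col (U * mat_diag N (\<lambda>l. \<Sum>i<N. a (T i) * s i l))"
    then have jl: "j < N" "l < N" by (simp_all add: carrier_matD [OF carrier] mat_diag_def)
    have prod_index: "(A * U) $$ (j, l) = (\<Sum>k<N. A $$ (j, k) * U $$ (k, l))"
      if "A \<in> carrier_mat N N" for A
      using jl by (simp add: carrier_matD [OF carrier] carrier_matD [OF that] scalar_prod_def lessThan_atLeast0)
    have "(lincomb a ?S * U) $$ (j, l) = (\<Sum>k<N. \<Sum>i<N. a (T i) * T i $$ (j, k) * U $$ (k, l))"
      using jl by (simp add: prod_index [OF lincomb_carrier] lincomb_index sum_distrib_right)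
    also have "\<dots> = (\<Sum>i<N. a (T i) * (\<Sum>k<N. T i $$ (j, k) * U $$ (k, l)))"
      by (subst sum.swap) (simp add: sum_distrib_left mult.assoc)
    also have "\<dots> = (\<Sum>i<N. a (T i) * (T i * U) $$ (j, l))"
      by (rule sum.cong [OF refl]) (simp add: prod_index [OF T])
    also have "\<dots> = (\<Sum>i<N. a (T i) * (U $$ (j, l) * s i l))"
      using jl by (intro sum.cong refl) (simp add: diag mat_diag_mult_right [OF carrier] del: index_mult_mat)
    also have "\<dots> = (U * mat_diag N (\<lambda>l. \<Sum>i<N. a (T i) * s i l)) $$ (j, l)"
      using jl by (simp add: mat_diag_mult_right [OF carrier] sum_distrib_left mult_ac del: index_mult_mat)
    finally show "(lincomb a ?S * U) $$ (j, l) = (U * mat_diag N (\<lambda>l. \<Sum>i<N. a (T i) * s i l)) $$ (j, l)" .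
  qed
  have "lin_indpt ?S"
  proof (rule finite_lin_indpt2 [OF _ S])
    fix a assume "lincomb a ?S = \<zero>\<^bsub>?V\<^esub>"
    then have "lincomb a ?S * U = 0\<^sub>m N N"
      using carrier by (simp add: diagonalized_algebra_def module_mat_simps)
    also have "\<dots> = U * mat_diag N (\<lambda>l. 0)"
      by (simp add: mat_diag_mult_right [OF carrier]) (auto intro: eq_matI)
    finally have "U * mat_diag N (\<lambda>l. \<Sum>i<N. a (T i) * s i l) = U * mat_diag N (\<lambda>l. 0)"
      by (simp only: lincomb_mult_U)
    from diag_cancel [OF this] have "\<forall>l<N. (\<Sum>i<N. a (T i) * s i l) = 0" by blast
    from indep [OF this] show "\<forall>v\<in>?S. a v = \<zero>\<^bsub>class_ring\<^esub>" by (auto simp: K)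
  qed simp
  moreover have "LinearCombinations.module.span class_ring ?V ?S = carrier ?V"
  proof
    show "span ?S \<subseteq> carrier ?V" using S by (rule span_is_subset2)
    show "carrier ?V \<subseteq> span ?S"
    proof
      fix M assume "M \<in> carrier ?V"
      then obtain f where M: "M \<in> carrier_mat N N" "M * U = U * mat_diag N f"
        by (auto simp: carrier_diagonalized_algebra_iff)
      from span [of f] obtain b where b: "\<forall>l<N. (\<Sum>i<N. b i * s i l) = f l" ..
      \<comment> \<open>Coefficients of a linear combination are indexed by matrices rather than by \<open>i < N\<close>.\<close>
      define a where "a = b \<circ> the_inv_into {..<N} T"
      have "(\<Sum>i<N. a (T i) * s i l) = f l" if "l < N" for l
        using b that by (simp add: a_def the_inv_into_f_f [OF inj])
      then have "mat_diag N (\<lambda>l. \<Sum>i<N. a (T i) * s i l) = mat_diag N f"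
        by (auto simp: mat_diag_def)
      then have "M * U = lincomb a ?S * U" by (simp only: M(2) lincomb_mult_U)
      then have "M = lincomb a ?S" by (rule mult_right_cancel [OF M(1) lincomb_carrier])
      then show "M \<in> span ?S"
        unfolding span_def by (auto simp: K)
    qed
  qed
  ultimately show "basis ?S" using S by (simp add: basis_def)
qed

text \<open>
  Rescaling rows and columns by nonzero factors preserves invertibility, so the array \<open>s\<close> is
  invertible because \<open>U\<close> is. Spanning uses the orthonormality of the columns of \<open>U\<close>, and
  independence that of its rows.
\<close>
lemma eigenvalues_complete:
  fixes s :: "nat \<Rightarrow> nat \<Rightarrow> complex" and r :: "nat \<Rightarrow> complex"
  assumes U: "\<And>i l. i < N \<Longrightarrow> l < N \<Longrightarrow> U $$ (i, l) = c * s i l * r l / r i"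
    and c: "c \<noteq> 0" and r: "\<And>i. i < N \<Longrightarrow> r i \<noteq> 0"
  shows "\<exists>a. \<forall>l<N. (\<Sum>i<N. a i * s i l) = f l"
    and "\<forall>l<N. (\<Sum>i<N. a i * s i l) = 0 \<Longrightarrow> i < N \<Longrightarrow> a i = 0"
proof -
  have rows: "(\<Sum>l<N. U $$ (i, l) * cnj (U $$ (j, l))) = of_bool (i = j)" if "i < N" "j < N" for i j
    using arg_cong [OF mult_adjoint, of "\<lambda>M. M $$ (i, j)"] that carrier adjoint_carrier
    by (auto simp: scalar_prod_def lessThan_atLeast0 mat_adjoint_index)
  have cols: "(\<Sum>i<N. cnj (U $$ (i, l)) * U $$ (i, m)) = of_bool (l = m)" if "l < N" "m < N" for l m
    using arg_cong [OF adjoint_mult, of "\<lambda>M. M $$ (l, m)"] that carrier adjoint_carrier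
    by (auto simp: scalar_prod_def lessThan_atLeast0 mat_adjoint_index)
  have s: "s i l = U $$ (i, l) * r i / (c * r l)" if "i < N" "l < N" for i l
    using U [OF that] c r [OF that(1)] r [OF that(2)] by (simp add: field_simps)
  show "\<exists>a. \<forall>l<N. (\<Sum>i<N. a i * s i l) = f l"
  proof (intro exI allI impI)
    \<comment> \<open>The coordinates of \<open>f\<close> scaled by \<open>r\<close> in the orthonormal rows of \<open>U\<close>, scaled back.\<close>
    let ?a = "\<lambda>i. c * (\<Sum>l<N. f l * r l * cnj (U $$ (i, l))) / r i"
    fix m assume m: "m < N"
    have "(\<Sum>i<N. ?a i * s i m) = (\<Sum>i<N. \<Sum>l<N. f l * r l / r m * (cnj (U $$ (i, l)) * U $$ (i, m)))"
      using m c r by (intro sum.cong refl) (simp add: s sum_distrib_left sum_distrib_right sum_divide_distrib mult_ac)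
    also have "\<dots> = (\<Sum>l<N. f l * r l / r m * (\<Sum>i<N. cnj (U $$ (i, l)) * U $$ (i, m)))"
      by (subst sum.swap) (simp add: sum_distrib_left)
    also have "\<dots> = (\<Sum>l<N. if l = m then f l * r l / r m else 0)"
      using m by (intro sum.cong refl) (simp add: cols)
    also have "\<dots> = f m" using m r by simp
    finally show "(\<Sum>i<N. ?a i * s i m) = f m" .
  qed
  assume zero: "\<forall>l<N. (\<Sum>i<N. a i * s i l) = 0" and i: "i < N"
  have "a i * r i = (\<Sum>j<N. if j = i then a j * r j else 0)" using i by simp
  also have "\<dots> = (\<Sum>j<N. a j * r j * (\<Sum>l<N. U $$ (j, l) * cnj (U $$ (i, l))))"
    using i by (intro sum.cong refl) (simp add: rows)
  also have "\<dots> = (\<Sum>l<N. c * r l * cnj (U $$ (i, l)) * (\<Sum>j<N. a j * s j l))"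
    unfolding sum_distrib_left
    by (subst sum.swap, intro sum.cong refl) (use c r in \<open>simp add: s\<close>)
  also have "\<dots> = 0" by (simp add: zero)
  finally show "a i = 0" using r [OF i] by simp
qed

end

section \<open>The matrices attached to an enumeration of the superclasses\<close>

locale enumerated_superclasses = symmetric_matrix_group +
  fixes N :: nat and X :: "nat \<Rightarrow> int vec set"
  assumes enum: "bij_betw X {..<N} SC"
begin

definition "c = complex_of_real (1 / sqrt (real n ^ d))"
definition "r j = complex_of_real (sqrt (real (card (X j))))"
abbreviation "s i l \<equiv> supercharacter_value n (X i) (X l)"
abbreviation "U \<equiv> U_mat n d N X"

lemma X_superclass: "i < N \<Longrightarrow> X i \<in> SC"
  using enum by (auto simp: bij_betw_def)

lemma X_eq_iff: "i < N \<Longrightarrow> j < N \<Longrightarrow> X i = X j \<longleftrightarrow> i = j"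
  using enum by (auto simp: bij_betw_def inj_on_eq_iff)

lemma sum_enumerated: "(\<Sum>W\<in>SC. f W) = (\<Sum>k<N. f (X k))"
  by (rule sum.reindex_bij_betw [OF enum, symmetric])

lemma r_nonzero: "i < N \<Longrightarrow> r i \<noteq> 0"
  using superclass_nonempty finite_superclass X_superclass by (simp add: r_def card_eq_0_iff)

lemma r_square: "r i * r i = of_nat (card (X i))"
  unfolding r_def of_real_mult [symmetric] by simp

lemma c_nonzero: "c \<noteq> 0" and c_square: "c * c = 1 / of_nat (n ^ d)"
  unfolding c_def of_real_mult [symmetric] using n_pos by simp_all

lemma cnj_r: "cnj (r i) = r i" and cnj_c: "cnj c = c"
  by (simp_all add: r_def c_def)

lemma supercharacter_value_mult:
  assumes "i < N" "j < N" "l < N"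
  shows "s i l * s j l = (\<Sum>k<N. of_nat (structure_const n (X i) (X j) (X k)) * s k l)"
proof -
  obtain \<xi> where \<xi>: "\<xi> \<in> X l" using superclass_nonempty [OF X_superclass [OF assms(3)]] by blast
  then have "\<xi> \<in> G" using superclass_subset [OF X_superclass [OF assms(3)]] by blast
  moreover have "s k l = \<sigma> (X k) \<xi>" if "k < N" for k
    using supercharacter_value [OF X_superclass [OF that] X_superclass [OF assms(3)] \<xi>] .
  ultimately show ?thesis
    using supercharacter_mult [OF X_superclass [OF assms(1)] X_superclass [OF assms(2)]] assms
    by (simp add: sum_enumerated)
qed

lemma U_carrier: "U \<in> carrier_mat N N"
  by (simp add: U_mat_def)

lemma U_index: "i < N \<Longrightarrow> l < N \<Longrightarrow> U $$ (i, l) = c * s i l * r l / r i"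
  by (simp add: U_mat_def c_def r_def)

lemma T_index:
  "j < N \<Longrightarrow> k < N \<Longrightarrow> T_mat n N X i $$ (j, k) = of_nat (structure_const n (X i) (X j) (X k)) * r k / r j"
  by (simp add: T_mat_def r_def)

lemma T_carrier: "T_mat n N X i \<in> carrier_mat N N"
  by (simp add: T_mat_def)

text \<open>
  Up to scaling, the entries of \<open>U U\<^sup>*\<close> are the weighted inner products of supercharacters.
  On the diagonal, the factors \<open>n ^ d\<close> and \<open>card (X i)\<close> cancel against \<open>c * c\<close> and \<open>r i * r i\<close>.
\<close>
lemma U_unitary: "U * mat_adjoint U = 1\<^sub>m N"
proof (rule eq_matI)
  fix i j assume "i < dim_row (1\<^sub>m N :: complex mat)" "j < dim_col (1\<^sub>m N :: complex mat)"
  then have ij: "i < N" "j < N" by simp_all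
  have "(U * mat_adjoint U) $$ (i, j) = (\<Sum>l<N. U $$ (i, l) * cnj (U $$ (j, l)))"
    using ij carrier_matD [OF U_carrier]
    by (simp add: scalar_prod_def lessThan_atLeast0 mat_adjoint_index)
  also have "\<dots> = (\<Sum>l<N. c * c / (r i * r j) * (r l * r l * (s i l * cnj (s j l))))"
    using ij by (intro sum.cong refl) (simp add: U_index cnj_r cnj_c mult_ac)
  also have "\<dots> = c * c / (r i * r j) * (\<Sum>l<N. of_nat (card (X l)) * (s i l * cnj (s j l)))"
    by (simp only: r_square sum_distrib_left)
  also have "\<dots> = c * c / (r i * r j) * (if i = j then of_nat (n ^ d * card (X i)) else 0)"
    using supercharacter_orthogonal [OF X_superclass [OF ij(1)] X_superclass [OF ij(2)]]
    by (simp only: sum_enumerated X_eq_iff [OF ij])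
  also have "\<dots> = (if i = j then c * c * of_nat (n ^ d) * (r i * r i / (r i * r i)) else 0)"
    by (simp add: r_square)
  also have "\<dots> = (if i = j then 1 else 0)"
    using r_nonzero [OF ij(1)] n_pos by (cases "i = j") (simp_all add: c_square)
  finally show "(U * mat_adjoint U) $$ (i, j) = 1\<^sub>m N $$ (i, j)" using ij by simp
qed (use carrier_matD [OF U_carrier] in simp_all)

sublocale unitary_mat N U
  by unfold_locales (rule U_carrier, rule U_unitary)

text \<open>
  The factor \<open>r k\<close> in column \<open>k\<close> of \<open>T\<^sub>i\<close> cancels the one in row \<open>k\<close> of \<open>U\<close>; what remains is
  the product formula multiplied by \<open>c * r l / r j\<close>.
\<close>
lemma T_mult_U:
  assumes i: "i < N"
  shows "T_mat n N X i * U = U * mat_diag N (s i)"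
proof (rule eq_matI)
  show "dim_row (T_mat n N X i * U) = dim_row (U * mat_diag N (s i))"
    "dim_col (T_mat n N X i * U) = dim_col (U * mat_diag N (s i))"
    using carrier_matD [OF U_carrier] by (simp_all add: T_mat_def mat_diag_def)
  fix j l assume "j < dim_row (U * mat_diag N (s i))" "l < dim_col (U * mat_diag N (s i))"
  then have jl: "j < N" "l < N"
    using carrier_matD [OF U_carrier] by (simp_all add: mat_diag_def)
  have "(T_mat n N X i * U) $$ (j, l) = (\<Sum>k<N. T_mat n N X i $$ (j, k) * U $$ (k, l))"
    using jl carrier_matD [OF U_carrier] carrier_matD [OF T_carrier]
    by (simp add: scalar_prod_def lessThan_atLeast0)
  also have "\<dots> = (\<Sum>k<N. c * r l / r j * (of_nat (structure_const n (X i) (X j) (X k)) * s k l))"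
    using jl r_nonzero by (intro sum.cong refl) (simp add: U_index T_index)
  also have "\<dots> = c * r l / r j * (s i l * s j l)"
    by (simp only: supercharacter_value_mult [OF i jl] sum_distrib_left)
  also have "\<dots> = (U * mat_diag N (s i)) $$ (j, l)"
    using jl by (simp add: mat_diag_mult_right [OF U_carrier] U_index)
  finally show "(T_mat n N X i * U) $$ (j, l) = (U * mat_diag N (s i)) $$ (j, l)" .
qed

lemma T_basis:
  "inj_on (T_mat n N X) {..<N}"
  "vectorspace.basis class_ring (diagonalized_algebra N U) (T_mat n N X ` {..<N})"
proof -
  have span: "\<exists>a. \<forall>l<N. (\<Sum>i<N. a i * s i l) = f l" for f
    by (rule eigenvalues_complete(1) [where r = r, OF U_index c_nonzero r_nonzero])
  have indep: "a i = 0" if "\<forall>l<N. (\<Sum>i<N. a i * s i l) = 0" "i < N" for a i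
    by (rule eigenvalues_complete(2) [where r = r and a = a and i = i, OF U_index c_nonzero r_nonzero])
      (use that in auto)
  note basis = basis_diagonalized_algebra [where s = "\<lambda>i. s i", OF T_carrier T_mult_U]
  show "inj_on (T_mat n N X) {..<N}"
    by (rule basis(1)) (assumption, fact span, fact indep)
  show "vectorspace.basis class_ring (diagonalized_algebra N U) (T_mat n N X ` {..<N})"
    by (rule basis(2)) (assumption, fact span, fact indep)
qed

end

theorem theorem2:
  fixes n d N :: nat
    and \<Gamma> :: "int mat set"
    and X :: "nat \<Rightarrow> int vec set"
  assumes "n \<ge> 1" and "d \<ge> 1"
    and "subgroup \<Gamma> (GL n d)"
    and "\<Gamma> = transpose_mat ` \<Gamma>"
    and "bij_betw X {..<N} (superclasses n d \<Gamma>)"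
  shows
    "(\<forall>i<N. \<forall>j<N. \<forall>k<N. \<forall>z\<in>X k. \<forall>z'\<in>X k.
        num_solutions n (X i) (X j) z = num_solutions n (X i) (X j) z')
     \<and> (\<forall>i<N. \<forall>j<N. \<forall>l<N.
        supercharacter_value n (X i) (X l) * supercharacter_value n (X j) (X l) =
        (\<Sum>k<N. of_nat (structure_const n (X i) (X j) (X k)) * supercharacter_value n (X k) (X l)))
     \<and> (\<forall>i<N. T_mat n N X i * U_mat n d N X = U_mat n d N X * D_mat n N X i)
     \<and> (\<forall>i<N. mat_adjoint (T_mat n N X i) * T_mat n N X i
             = T_mat n N X i * mat_adjoint (T_mat n N X i))
     \<and> inj_on (T_mat n N X) {..<N}
     \<and> vectorspace.basis class_ring (diagonalized_algebra N (U_mat n d N X)) (T_mat n N X ` {..<N})"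
proof -
  interpret enumerated_superclasses n d \<Gamma> N X
    using assms
    by (intro enumerated_superclasses.intro symmetric_matrix_group.intro
        enumerated_superclasses_axioms.intro)
  show ?thesis
    using num_solutions_constant X_superclass supercharacter_value_mult T_mult_U
      normal_if_diagonalized [OF T_carrier T_mult_U] T_basis
    unfolding D_mat_def by blast
qed

end
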